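(* Let $n\ge 2$ be an integer, let $\alpha\in\mathbb{R}$ with $\alpha\notin\{-\tfrac n2,-\tfrac n2-1,-\tfrac n2-2,\dots\}$, put $\rho=\alpha+\frac{n-1}{2}$, and assume $\rho\neq 0$ and $\rho\ne 1$. For $\beta\in(0,1)$ put $$r_0=r_0(\beta)=\frac{\rho-1-\beta n+\beta}{2},\qquad r_1=r_1(\beta)=r_0-\Bigl(\beta+\frac12\Bigr).$$ Then for Lebesgue-almost every $\beta\in(0,1)$ the following holds: for every $c>0$ the inequality $$\bigl|\,j\sin\bigl(\pi(j\beta-r_0)\bigr)+\rho(\rho-1)\sin\bigl(\pi(j\beta-r_1)\bigr)\bigr|<c$$ has infinitely many solutions $j\in\mathbb{N}$.
   Context: $\mathbb{N}$ denotes the positive integers. All objects are defined in the claim. *)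

theory Defs
  imports "HOL-Analysis.Analysis"
begin

definition rho :: "nat \<Rightarrow> real \<Rightarrow> real" where
  "rho n \<alpha> = \<alpha> + (real n - 1) / 2"

definition r0 :: "nat \<Rightarrow> real \<Rightarrow> real \<Rightarrow> real" where
  "r0 n \<alpha> \<beta> = (rho n \<alpha> - 1 - \<beta> * real n + \<beta>) / 2"

definition r1 :: "nat \<Rightarrow> real \<Rightarrow> real \<Rightarrow> real" where
  "r1 n \<alpha> \<beta> = r0 n \<alpha> \<beta> - (\<beta> + 1 / 2)"

end

theory Submission
  imports Defs "HOL-Number_Theory.Cong"
begin

text \<open>
  With \<open>a = (n - 1) / 2\<close>, \<open>t = (\<rho> - 1) / 2\<close> and \<open>K = \<rho> (\<rho> - 1)\<close> the expression to be made small is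
  \<open>f\<^sub>j(\<beta>) = j sin (\<pi> ((j + a) \<beta> - t)) + K sin (\<pi> ((j + a + 1) \<beta> - t + 1/2))\<close>.
  The first term is of bounded size exactly when \<open>(j + a) \<beta> - t\<close> is within \<open>O(1/j)\<close> of an integer,
  and then moving \<open>\<beta>\<close> by \<open>O(1/j\<^sup>2)\<close> is enough to cancel the bounded second term. So the problem
  is one of inhomogeneous Diophantine approximation at the critical rate \<open>1/j\<close>, with an arbitrarily
  small constant, a target \<open>t - a \<beta>\<close> that moves with \<open>\<beta>\<close>, and a further correction of order \<open>1/j\<close>.

  Approximation with some fixed constant holds at every irrational \<open>\<beta>\<close>: by
  \<open>inhomogeneous_approximation\<close>, \<open>(j + a) \<beta> - t\<close> is within \<open>5/j\<close> of an integer for infinitely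
  many \<open>j\<close>. For such \<open>j\<close> the intermediate value theorem gives a zero of \<open>f\<^sub>j\<close> at distance
  \<open>O(1/j\<^sup>2)\<close> from \<open>\<beta>\<close> (\<open>perturbed_sine_zero_near\<close>), and since \<open>f\<^sub>j\<close> is Lipschitz with constant
  \<open>O(j\<^sup>2)\<close> (\<open>perturbed_sine_lipschitz\<close>), \<open>\<bar>f\<^sub>j\<bar> < c\<close> on an interval of length comparable to
  \<open>1/j\<^sup>2\<close> around that zero.

  The passage from a fixed constant to an arbitrarily small one costs only a null set, by the
  argument behind Cassels' lemma on limsup sets of intervals with proportional lengths. If \<open>S\<close> is the
  set of irrational \<open>\<beta>\<close> with \<open>\<bar>f\<^sub>j(\<beta>)\<bar> \<ge> c\<close> for all \<open>j \<ge> N\<close>, then the previous paragraph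
  shows that at every point of \<open>S\<close> and at arbitrarily small scales, \<open>S\<close> misses a fixed proportion
  of the surrounding interval. A measurable set with this property has no density points and is
  therefore null (\<open>negligible_porous\<close>). The exceptional set consists of rational numbers and a
  countable union of such sets \<open>S\<close>.
\<close>

section \<open>Porous sets are null\<close>

text \<open>
  A Vitali covering argument. Choose an open \<open>U \<supseteq> S\<close> with \<open>U - S\<close> of small measure and cover almost
  all of \<open>S\<close> by disjoint balls inside \<open>U\<close>, each with a hole of proportional volume. The holes are
  disjoint subsets of \<open>U - S\<close>, so their total volume is small; the total volume of the balls is at
  most \<open>\<kappa>\<close> to the power \<open>-DIM('a)\<close> times as large, hence small as well. Only \<open>U - S\<close>
  is compared with the balls, so the measure of \<open>S\<close> may be infinite.
\<close>

lemma negligible_porous: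
  fixes S :: "'a::euclidean_space set"
  assumes S: "S \<in> sets lebesgue" and "\<kappa> > 0"
    and holes: "\<And>x d. \<lbrakk>x \<in> S; d > 0\<rbrakk> \<Longrightarrow>
      \<exists>r y. 0 < r \<and> r < d \<and> ball y (\<kappa> * r) \<subseteq> ball x r - S"
  shows "negligible S"
proof (simp only: negligible_outer_le, intro allI impI)
  fix e :: real
  assume "e > 0"
  let ?\<mu> = "measure lebesgue"
  \<comment> \<open>the ratio of the volume of a hole to that of its ball\<close>
  define \<theta> where "\<theta> = \<kappa> ^ DIM('a)"
  have "\<theta> > 0" using \<open>\<kappa> > 0\<close> by (simp add: \<theta>_def)
  have "\<theta> * e > 0" using \<open>\<theta> > 0\<close> \<open>e > 0\<close> by simp
  obtain U where "open U" "S \<subseteq> U" and US: "U - S \<in> lmeasurable"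
    and mUS: "emeasure lebesgue (U - S) < ennreal (\<theta> * e)"
    using sets_lebesgue_outer_open [OF S \<open>\<theta> * e > 0\<close>] by metis
  have mUS': "?\<mu> (U - S) \<le> \<theta> * e"
    using mUS US \<open>\<theta> * e > 0\<close> emeasure_eq_measure2 [OF US]
    by (simp add: ennreal_less_iff)
  define K where "K = {(x::'a, r). 0 < r \<and> ball x r \<subseteq> U \<and> (\<exists>y. ball y (\<kappa> * r) \<subseteq> ball x r - S)}"
  obtain C where "countable C" "C \<subseteq> K"
    and disj: "pairwise (\<lambda>i j. disjnt (ball (fst i) (snd i)) (ball (fst j) (snd j))) C"
    and rest: "negligible (S - (\<Union>i\<in>C. ball (fst i) (snd i)))"
  proof (rule Vitali_covering_theorem_balls [of S K fst snd])
    fix x and d :: real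
    assume x: "x \<in> S" and "d > 0"
    obtain k where "k > 0" and k: "ball x k \<subseteq> U"
      using x \<open>S \<subseteq> U\<close> \<open>open U\<close> by (meson openE subsetD)
    obtain r y where r: "0 < r" "r < min d k" "ball y (\<kappa> * r) \<subseteq> ball x r - S"
      using holes [OF x, of "min d k"] \<open>k > 0\<close> \<open>d > 0\<close> by auto
    have "ball x r \<subseteq> U"
      using r(2) k subset_ball [of r k x] by auto
    then have "(x, r) \<in> K"
      using r by (auto simp: K_def)
    then show "\<exists>i. i \<in> K \<and> x \<in> ball (fst i) (snd i) \<and> snd i < d"
      using r by (intro exI [of _ "(x, r)"]) auto
  qed blast
  define B where "B i = ball (fst i) (snd i)" for i :: "'a \<times> real"
  have "\<exists>y. ball y (\<kappa> * snd i) \<subseteq> B i - S" if "i \<in> C" for i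
    using subsetD [OF \<open>C \<subseteq> K\<close> that] by (auto simp: K_def B_def case_prod_unfold)
  then obtain y where y: "\<And>i. i \<in> C \<Longrightarrow> ball (y i) (\<kappa> * snd i) \<subseteq> B i - S"
    by metis
  define H where "H i = ball (y i) (\<kappa> * snd i)" for i
  have H_sub: "H i \<subseteq> B i - S" if "i \<in> C" for i
    using y that by (simp add: H_def)
  have B_sub: "B i \<subseteq> U" and pos: "snd i > 0" if "i \<in> C" for i
    using subsetD [OF \<open>C \<subseteq> K\<close> that] by (auto simp: K_def B_def case_prod_unfold)
  have B_H: "?\<mu> (B i) = ?\<mu> (H i) / \<theta>" if "i \<in> C" for i
    using pos [OF that] \<open>\<kappa> > 0\<close>
      content_ball_conv_unit_ball [of "snd i" "fst i"]
      content_ball_conv_unit_ball [of "\<kappa> * snd i" "y i"]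
    by (simp add: B_def H_def \<theta>_def power_mult_distrib)
  have finite_bound: "?\<mu> (\<Union>i\<in>I. B i) \<le> e" if "I \<subseteq> C" "finite I" for I
  proof -
    have disjH: "pairwise (\<lambda>i j. disjnt (H i) (H j)) I"
      using disj that(1) H_sub unfolding pairwise_def disjnt_def B_def by blast
    have "?\<mu> (\<Union>i\<in>I. B i) \<le> (\<Sum>i\<in>I. ?\<mu> (B i))"
      using that by (intro measure_UNION_le) (auto simp: B_def)
    also have "\<dots> = (\<Sum>i\<in>I. ?\<mu> (H i)) / \<theta>"
      using B_H that(1) by (auto simp: sum_divide_distrib intro!: sum.cong)
    also have "(\<Sum>i\<in>I. ?\<mu> (H i)) = ?\<mu> (\<Union>i\<in>I. H i)"
      using that disjH by (intro measure_UNION' [symmetric]) (auto simp: H_def)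
    also have "?\<mu> (\<Union>i\<in>I. H i) \<le> ?\<mu> (U - S)"
    proof (rule measure_mono_fmeasurable [OF _ _ US])
      show "(\<Union>i\<in>I. H i) \<subseteq> U - S"
        using H_sub B_sub that(1) by blast
      show "(\<Union>i\<in>I. H i) \<in> sets lebesgue"
        using that(2) by (auto simp: H_def intro!: sets.finite_UN)
    qed
    also have "?\<mu> (U - S) / \<theta> \<le> e"
      using mUS' \<open>\<theta> > 0\<close> by (simp add: field_simps)
    finally show ?thesis
      using \<open>\<theta> > 0\<close> by (simp add: divide_right_mono)
  qed
  have B_meas: "B i \<in> lmeasurable" for i
    by (simp add: B_def)
  have W: "(\<Union>i\<in>C. B i) \<in> lmeasurable" "?\<mu> (\<Union>i\<in>C. B i) \<le> e"
    using fmeasurable_UN_bound [OF \<open>countable C\<close>, of B lebesgue e]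
      measure_UN_bound [OF \<open>countable C\<close>, of B lebesgue e] B_meas finite_bound by auto
  have rest': "negligible (S - (\<Union>i\<in>C. B i))"
    using rest by (simp add: B_def)
  let ?T = "(S - (\<Union>i\<in>C. B i)) \<union> (\<Union>i\<in>C. B i)"
  have "?\<mu> ?T = ?\<mu> (\<Union>i\<in>C. B i)"
    using W(1) rest' by (intro measure_negligible_symdiff) (auto intro: negligible_subset [OF rest'])
  then show "\<exists>T. S \<subseteq> T \<and> T \<in> lmeasurable \<and> ?\<mu> T \<le> e"
    using W(2) fmeasurable.Un [OF negligible_imp_measurable [OF rest'] W(1)]
    by (intro exI [of _ ?T]) auto
qed

section \<open>Inhomogeneous approximation with a fixed constant\<close>

text \<open>
  A weak form of a theorem of Khinchin and Minkowski. Take a reduced fraction \<open>p/q\<close> within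
  \<open>1/q\<^sup>2\<close> of \<open>\<beta>\<close>, where irrationality makes \<open>q\<close> as large as desired, and the integer \<open>a\<close>
  nearest to \<open>q \<gamma>\<close>. Some \<open>J\<close> with \<open>q \<le> J < 2 q\<close> satisfies \<open>p J \<equiv> a\<close> modulo \<open>q\<close>. Replacing
  \<open>\<beta>\<close> by \<open>p/q\<close> and \<open>\<gamma>\<close> by \<open>a/q\<close> turns \<open>J \<beta> - \<gamma>\<close> into an integer, at a cost of at most
  \<open>J/q\<^sup>2 + 1/(2 q) \<le> 5/J\<close>.
\<close>

lemma inhomogeneous_approximation:
  fixes \<beta> \<gamma> :: real
  assumes "\<beta> \<notin> \<rat>"
  obtains j :: nat and m :: int
  where "j \<ge> N" "j > 0" "\<bar>real j * \<beta> - \<gamma> - of_int m\<bar> \<le> 5 / real j"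
proof -
  obtain p q where pq: "(p, q) \<in> approx_set \<beta>" "q > int N"
    using rational_iff_finite_approx_set infinite_approx_set assms by blast
  then have "q > 0" and "coprime p q" and close: "\<bar>\<beta> - of_int p / of_int q\<bar> < 1 / (of_int q)\<^sup>2"
    by (auto simp: approx_set_def)
  define a where "a = round (of_int q * \<gamma>)"
  have a: "\<bar>of_int q * \<gamma> - of_int a\<bar> \<le> 1 / 2"
    using of_int_round_abs_le [of "of_int q * \<gamma>"] by (simp add: a_def abs_minus_commute)
  obtain x where x: "[p * x = a] (mod q)"
    using cong_solve_coprime_int [OF \<open>coprime p q\<close>]
    by (metis cong_scalar_right mult.assoc mult_1)
  define J where "J = q + x mod q"
  have J: "q \<le> J" "J < 2 * q"
    using \<open>q > 0\<close> by (auto simp: J_def)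
  have "[p * J = a] (mod q)"
    using x by (simp add: J_def cong_def mod_simps distrib_left)
  then obtain m where m: "p * J - a = q * m"
    by (metis cong_iff_dvd_diff dvdE)
  have "real_of_int J * \<beta> - \<gamma> - of_int m
      = of_int J * (\<beta> - of_int p / of_int q) - (of_int q * \<gamma> - of_int a) / of_int q"
  proof -
    have "real_of_int p * of_int J - of_int a = of_int q * of_int m"
      using m by (metis of_int_diff of_int_mult)
    then have m_eq: "real_of_int m = (of_int p * of_int J - of_int a) / of_int q"
      using \<open>q > 0\<close> by simp
    show ?thesis
      unfolding m_eq using \<open>q > 0\<close> by (simp add: field_simps)
  qed
  also have "\<bar>\<dots>\<bar> \<le> of_int J * \<bar>\<beta> - of_int p / of_int q\<bar> + \<bar>of_int q * \<gamma> - of_int a\<bar> / of_int q"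
    using \<open>q > 0\<close> J by (simp add: abs_mult order_trans [OF abs_triangle_ineq4])
  also have "\<dots> \<le> of_int J * (1 / (of_int q)\<^sup>2) + (1 / 2) / of_int q"
    using \<open>q > 0\<close> J close a by (intro add_mono mult_left_mono divide_right_mono) auto
  also have "\<dots> \<le> 5 / of_int J"
  proof -
    define s where "s = real_of_int J / of_int q"
    have "0 < s" "s \<le> 2"
      using J \<open>q > 0\<close> by (auto simp: s_def field_simps)
    then have "s * s + s / 2 \<le> 5"
      using mult_mono [of s 2 s 2] by simp
    moreover have "of_int J * (1 / (of_int q)\<^sup>2) + (1 / 2) / of_int q = (s * s + s / 2) / real_of_int J"
      using J \<open>q > 0\<close> by (simp add: s_def field_simps power2_eq_square)
    ultimately show ?thesis
      using J \<open>q > 0\<close> by (simp add: divide_right_mono)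
  qed
  finally have "\<bar>real (nat J) * \<beta> - \<gamma> - of_int m\<bar> \<le> 5 / real (nat J)"
    using J \<open>q > 0\<close> by simp
  then show thesis
    using that [of "nat J" m] J \<open>q > 0\<close> pq(2) by simp
qed

section \<open>Zeros of the perturbed sine\<close>

lemma half_le_sin:
  fixes x :: real
  assumes "0 \<le> x" "x \<le> 1"
  shows "x / 2 \<le> sin x"
proof (cases "x = 0")
  case False
  then obtain z where z: "0 < z" "z < x" "sin x - sin 0 = (x - 0) * cos z"
    using MVT2 [of 0 x sin cos] assms by (auto intro: DERIV_sin)
  have "cos (pi / 3) \<le> cos z"
    using z assms pi_gt3 by (intro cos_monotone_0_pi_le) auto
  then have "x * (1 / 2) \<le> x * cos z"
    using assms by (intro mult_left_mono) (auto simp: cos_60)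
  then show ?thesis
    using z by simp
qed simp

text \<open>
  The phase \<open>s\<close> of the perturbation is independent of \<open>t\<close>: only the size \<open>\<bar>K\<bar>\<close> of the second
  term and its frequency, which is of order \<open>j\<close>, enter the argument.
\<close>

definition perturbed_sine :: "real \<Rightarrow> real \<Rightarrow> real \<Rightarrow> real \<Rightarrow> nat \<Rightarrow> real \<Rightarrow> real" where
  "perturbed_sine a t K s j b =
    real j * sin (pi * ((real j + a) * b - t)) + K * sin (pi * ((real j + a + 1) * b - s))"

lemma continuous_on_perturbed_sine [continuous_intros]: "continuous_on A (perturbed_sine a t K s j)"
  unfolding perturbed_sine_def by (intro continuous_intros)

lemma abs_sin_diff_le: "\<bar>sin x - sin y\<bar> \<le> \<bar>x - y\<bar>" for x y :: real
proof -
  have "\<bar>sin x - sin y\<bar> = 2 * \<bar>sin ((x - y) / 2)\<bar> * \<bar>cos ((x + y) / 2)\<bar>"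
    by (simp add: sin_diff_sin abs_mult)
  also have "\<dots> \<le> 2 * \<bar>(x - y) / 2\<bar> * 1"
    by (intro mult_mono abs_sin_x_le_abs_x) auto
  finally show ?thesis by simp
qed

text \<open>
  The order \<open>j\<^sup>2\<close>, from the product of amplitude and frequency of the first term, is what makes
  the interval on which \<open>\<bar>f\<^sub>j\<bar> < c\<close> around a zero comparable to the distance at which the zero is found.
\<close>

lemma perturbed_sine_lipschitz:
  assumes "a \<ge> 0" "real j \<ge> a + 1"
  shows "\<bar>perturbed_sine a t K s j x - perturbed_sine a t K s j y\<bar> \<le> 2 * pi * (1 + \<bar>K\<bar>) * (real j)\<^sup>2 * \<bar>x - y\<bar>"
proof -
  have sin_le: "\<bar>sin (pi * (w * x - u)) - sin (pi * (w * y - u))\<bar> \<le> pi * (2 * real j) * \<bar>x - y\<bar>"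
    if "0 \<le> w" "w \<le> 2 * real j" for w u
  proof -
    have "\<bar>sin (pi * (w * x - u)) - sin (pi * (w * y - u))\<bar>
        \<le> \<bar>pi * (w * x - u) - pi * (w * y - u)\<bar>"
      by (rule abs_sin_diff_le)
    also have "\<dots> = \<bar>pi * w * (x - y)\<bar>"
      by (simp add: algebra_simps)
    also have "\<dots> = pi * w * \<bar>x - y\<bar>"
      using that by (simp add: abs_mult)
    also have "\<dots> \<le> pi * (2 * real j) * \<bar>x - y\<bar>"
      using that by (intro mult_right_mono mult_left_mono) auto
    finally show ?thesis .
  qed
  have "\<bar>perturbed_sine a t K s j x - perturbed_sine a t K s j y\<bar>
      = \<bar>real j * (sin (pi * ((real j + a) * x - t)) - sin (pi * ((real j + a) * y - t)))
         + K * (sin (pi * ((real j + a + 1) * x - s)) - sin (pi * ((real j + a + 1) * y - s)))\<bar>"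
    by (simp add: perturbed_sine_def right_diff_distrib)
  also have "\<dots> \<le> real j * \<bar>sin (pi * ((real j + a) * x - t)) - sin (pi * ((real j + a) * y - t))\<bar>
         + \<bar>K\<bar> * \<bar>sin (pi * ((real j + a + 1) * x - s)) - sin (pi * ((real j + a + 1) * y - s))\<bar>"
    by (rule order_trans [OF abs_triangle_ineq]) (simp add: abs_mult)
  also have "\<dots> \<le> real j * (pi * (2 * real j) * \<bar>x - y\<bar>) + \<bar>K\<bar> * (pi * (2 * real j) * \<bar>x - y\<bar>)"
    using assms by (intro add_mono mult_left_mono sin_le) auto
  also have "\<dots> \<le> real j * (pi * (2 * real j) * \<bar>x - y\<bar>) + (\<bar>K\<bar> * real j) * (pi * (2 * real j) * \<bar>x - y\<bar>)"
  proof -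
    have "\<bar>K\<bar> * 1 \<le> \<bar>K\<bar> * real j"
      using assms by (intro mult_left_mono) auto
    then show ?thesis
      by (intro add_left_mono mult_right_mono) auto
  qed
  finally show ?thesis
    by (simp add: algebra_simps power2_eq_square)
qed

text \<open>
  Let \<open>e v\<close> be the point where the argument \<open>(j + a) x - t\<close> equals \<open>m + v/j\<close>. As \<open>v\<close> runs
  from \<open>-D\<close> to \<open>D\<close>, the main term moves, up to the sign \<open>(-1)\<^sup>m\<close>, from at most \<open>-D\<close> to at
  least \<open>D\<close>; as \<open>\<bar>K\<bar> < D\<close>, the perturbation cannot prevent a change of sign in between.
\<close>

lemma perturbed_sine_zero_near:
  fixes m :: int
  assumes "a \<ge> 0" "j > 0" "D \<ge> 1" "\<bar>K\<bar> < D" "pi * D \<le> real j"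
    and near: "\<bar>(real j + a) * b - t - of_int m\<bar> \<le> E / real j"
  obtains b' where "\<bar>b' - b\<bar> \<le> (D + E) / (real j)\<^sup>2" "perturbed_sine a t K s j b' = 0"
proof -
  define w where "w = real j + a"
  have w: "w \<ge> real j" "w > 0"
    using assms by (auto simp: w_def)
  define e where "e v = (t + of_int m + v / real j) / w" for v
  have e_arg: "w * e v - t = of_int m + v / real j" for v
    using w by (simp add: e_def)
  \<comment> \<open>the factor is the sign \<open>(-1)\<^sup>m\<close>; it gives \<open>F\<close> the sign of \<open>v\<close> at \<open>e v\<close>, \<open>v = \<plusminus>D\<close>, for either parity of \<open>m\<close>\<close>
  define F where "F x = cos (pi * of_int m) * perturbed_sine a t K s j x" for x
  have "cos (pi * real_of_int m) * cos (pi * of_int m) = 1"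
    using sin_cos_squared_add3 [of "pi * real_of_int m"] by (simp add: sin_int_times_real mult.commute)
  then have cos_m: "\<bar>cos (pi * real_of_int m)\<bar> = 1"
    by (metis abs_mult_self_eq abs_square_eq_1 power2_eq_square)
  have F_e: "\<bar>F (e v) - real j * sin (pi * v / real j)\<bar> \<le> \<bar>K\<bar>" for v
  proof -
    let ?R = "sin (pi * ((real j + a + 1) * e v - s))"
    have "sin (pi * (w * e v - t)) = cos (pi * of_int m) * sin (pi * v / real j)"
      unfolding e_arg by (simp add: distrib_left sin_add sin_int_times_real mult.commute)
    then have "F (e v) = (cos (pi * real_of_int m) * cos (pi * of_int m)) * (real j * sin (pi * v / real j))
        + cos (pi * of_int m) * (K * ?R)"
      by (simp add: F_def perturbed_sine_def flip: w_def)
    then have "F (e v) - real j * sin (pi * v / real j) = cos (pi * of_int m) * (K * ?R)"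
      using \<open>cos (pi * real_of_int m) * cos (pi * of_int m) = 1\<close> by simp
    also have "\<bar>\<dots>\<bar> = \<bar>K\<bar> * \<bar>?R\<bar>"
      using cos_m by (simp add: abs_mult)
    also have "\<dots> \<le> \<bar>K\<bar> * 1"
      by (intro mult_left_mono) auto
    finally show ?thesis by simp
  qed
  have "D \<le> real j * ((pi * D / real j) / 2)"
    using assms pi_gt3 mult_right_mono [of 2 pi D] by simp
  also have "\<dots> \<le> real j * sin (pi * D / real j)"
    using assms by (intro mult_left_mono half_le_sin) auto
  finally have big: "D \<le> real j * sin (pi * D / real j)" .
  have "F (e (- D)) \<le> 0" "0 \<le> F (e D)"
    using F_e [of D] F_e [of "- D"] big \<open>\<bar>K\<bar> < D\<close> by auto
  moreover have "e (- D) \<le> e D"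
    using w assms by (auto simp: e_def intro!: divide_right_mono)
  moreover have "continuous_on {e (- D)..e D} F"
    unfolding F_def by (intro continuous_intros)
  ultimately obtain b' where b': "e (- D) \<le> b'" "b' \<le> e D" "F b' = 0"
    using IVT' [of F "e (- D)" 0 "e D"] by blast
  have dist_e: "\<bar>e v - b\<bar> \<le> (D + E) / (real j)\<^sup>2" if "\<bar>v\<bar> = D" for v
  proof -
    have "e v - b = (v / real j - (w * b - t - of_int m)) / w"
      using w by (simp add: e_def field_simps)
    also have "\<bar>\<dots>\<bar> \<le> (D / real j + E / real j) / w"
      unfolding abs_divide using w near that assms
      by (simp add: divide_right_mono order_trans [OF abs_triangle_ineq4] flip: w_def)
    also have "\<dots> \<le> (D / real j + E / real j) / real j"
    proof -
      have "0 \<le> E / real j"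
        using near by linarith
      then show ?thesis
        using w assms by (intro divide_left_mono) auto
    qed
    finally show ?thesis
      by (simp add: power2_eq_square add_divide_distrib)
  qed
  have "\<bar>b' - b\<bar> \<le> (D + E) / (real j)\<^sup>2"
    using b' dist_e [of D] dist_e [of "- D"] \<open>D \<ge> 1\<close> by auto
  moreover have "perturbed_sine a t K s j b' = 0"
    using b'(3) cos_m by (auto simp: F_def)
  ultimately show thesis
    using that by blast
qed

section \<open>The exceptional set\<close>

text \<open>
  The set is porous: at a scale \<open>M/j\<^sup>2\<close> around one of its points \<open>b\<close> lies a zero of \<open>f\<^sub>j\<close>,
  and the surrounding interval of radius \<open>c/(L j\<^sup>2)\<close>, where \<open>L j\<^sup>2\<close> is the Lipschitz constant, is
  a hole. The ratio \<open>c/(L M)\<close> of the two radii does not depend on \<open>j\<close>.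
\<close>

lemma negligible_perturbed_sine_bounded_below:
  assumes "a \<ge> 0" "c > 0"
  shows "negligible {b. b \<notin> \<rat> \<and> (\<forall>j\<ge>N. c \<le> \<bar>perturbed_sine a t K s j b\<bar>)}" (is "negligible ?S")
proof -
  define D where "D = 1 + \<bar>K\<bar>"
  define L where "L = 2 * pi * (1 + \<bar>K\<bar>)"
  \<comment> \<open>distance from \<open>b\<close> to the zero plus radius of the hole, both in units of \<open>1/j\<^sup>2\<close>\<close>
  define M where "M = D + 5 + c / L"
  have "L > 0" by (auto simp: L_def intro!: mult_pos_pos)
  then have "c / L > 0" using \<open>c > 0\<close> by simp
  then have "M > 0" by (simp add: M_def D_def)
  show ?thesis
  proof (rule negligible_porous [where \<kappa> = "c / L / M"])
    have "closed {b. \<forall>j\<ge>N. c \<le> \<bar>perturbed_sine a t K s j b\<bar>}"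
      by (intro closed_Collect_all closed_Collect_imp closed_Collect_le continuous_intros) auto
    moreover have "(\<rat> :: real set) \<in> sets borel"
      by (simp add: countable_rat sets.countable)
    moreover have "?S = {b. \<forall>j\<ge>N. c \<le> \<bar>perturbed_sine a t K s j b\<bar>} - \<rat>"
      by auto
    ultimately show "?S \<in> sets lebesgue"
      by (simp add: borel_closed sets.Diff sets_completionI_sets)
    show "c / L / M > 0"
      using \<open>c / L > 0\<close> \<open>M > 0\<close> by (rule divide_pos_pos)
  next
    fix b d :: real
    assume "b \<in> ?S" and "d > 0"
    then have "b \<notin> \<rat>" by simp
    \<comment> \<open>\<open>a + 1\<close> is for the Lipschitz bound, \<open>pi * D\<close> for the zero, \<open>M / d\<close> for a scale below \<open>d\<close>\<close>
    obtain N' :: nat where N': "real N' \<ge> max (max (a + 1) (pi * D)) (max (real N) (M / d + 1))"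
      using real_arch_simple by blast
    \<comment> \<open>the target \<open>t - a b\<close> depends on \<open>b\<close>, which is harmless as \<open>b\<close> is fixed here\<close>
    obtain j m where "j \<ge> N'" "j > 0" and m: "\<bar>real j * b - (t - a * b) - of_int m\<bar> \<le> 5 / real j"
      using inhomogeneous_approximation [OF \<open>b \<notin> \<rat>\<close>, of N' "t - a * b"] by blast
    then have j: "real j \<ge> a + 1" "pi * D \<le> real j" "j \<ge> N" "M / d < real j"
      using N' by auto
    have near: "\<bar>(real j + a) * b - t - of_int m\<bar> \<le> 5 / real j"
      using m by (simp add: algebra_simps)
    obtain b' where b': "\<bar>b' - b\<bar> \<le> (D + 5) / (real j)\<^sup>2" "perturbed_sine a t K s j b' = 0"
      using perturbed_sine_zero_near [OF \<open>a \<ge> 0\<close> \<open>j > 0\<close> _ _ j(2) near, of K s] by (auto simp: D_def)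
    define r where "r = M / (real j)\<^sup>2"
    have "r > 0" using \<open>M > 0\<close> \<open>j > 0\<close> by (simp add: r_def)
    have "r \<le> M / real j"
      using \<open>M > 0\<close> \<open>j > 0\<close> by (auto simp: r_def power2_eq_square intro!: divide_left_mono)
    also have "\<dots> < d"
      using j(4) \<open>d > 0\<close> \<open>j > 0\<close> by (simp add: field_simps)
    finally have "r < d" .
    have \<kappa>r: "c / L / M * r = c / L / (real j)\<^sup>2"
      using \<open>M > 0\<close> by (simp add: r_def)
    have "x \<in> ball b r - ?S" if "x \<in> ball b' (c / L / M * r)" for x
    proof -
      have x: "\<bar>x - b'\<bar> < c / L / (real j)\<^sup>2"
        using that unfolding \<kappa>r by (simp add: dist_real_def abs_minus_commute)
      have "\<bar>x - b\<bar> < (D + 5) / (real j)\<^sup>2 + c / L / (real j)\<^sup>2"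
        using x b'(1) by linarith
      then have "\<bar>x - b\<bar> < r"
        by (simp add: r_def M_def add_divide_distrib)
      moreover have "\<bar>perturbed_sine a t K s j x\<bar> < c"
      proof -
        have "\<bar>perturbed_sine a t K s j x\<bar> \<le> L * (real j)\<^sup>2 * \<bar>x - b'\<bar>"
          using perturbed_sine_lipschitz [OF \<open>a \<ge> 0\<close> j(1), of t K s x b'] b'(2) by (simp add: L_def)
        also have "\<dots> < L * (real j)\<^sup>2 * (c / L / (real j)\<^sup>2)"
          using x \<open>L > 0\<close> \<open>j > 0\<close> by (intro mult_strict_left_mono) auto
        also have "\<dots> = c"
          using \<open>L > 0\<close> \<open>j > 0\<close> by simp
        finally show ?thesis .
      qed
      ultimately show ?thesis
        using \<open>j \<ge> N\<close> by (force simp: dist_real_def abs_minus_commute)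
    qed
    then show "\<exists>r y. 0 < r \<and> r < d \<and> ball y (c / L / M * r) \<subseteq> ball b r - ?S"
      using \<open>r > 0\<close> \<open>r < d\<close> by blast
  qed
qed

lemma AE_infinite_small_perturbed_sine:
  assumes "a \<ge> 0"
  shows "AE b in lebesgue. \<forall>c>0. infinite {j. j \<ge> 1 \<and> \<bar>perturbed_sine a t K s j b\<bar> < c}"
proof -
  define Z where "Z k N = {b. b \<notin> \<rat> \<and> (\<forall>j\<ge>N. 1 / real (Suc k) \<le> \<bar>perturbed_sine a t K s j b\<bar>)}" for k N :: nat
  have "negligible (\<rat> \<union> (\<Union>(k, N)\<in>UNIV. Z k N))"
  proof (rule negligible_Un)
    show "negligible (\<rat> :: real set)"
      using countable_imp_null_set_lborel [OF countable_rat]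
      by (metis negligible_iff_null_sets null_sets_completionI)
    show "negligible (\<Union>(k, N)\<in>UNIV. Z k N)"
      using negligible_perturbed_sine_bounded_below [OF assms]
      by (intro negligible_countable_Union) (auto simp: Z_def)
  qed
  moreover have "{b \<in> space lebesgue. \<not> (\<forall>c>0. infinite {j. j \<ge> 1 \<and> \<bar>perturbed_sine a t K s j b\<bar> < c})}
      \<subseteq> \<rat> \<union> (\<Union>(k, N)\<in>UNIV. Z k N)"
  proof clarsimp
    fix b c :: real
    assume "c > 0" and fin: "finite {j. Suc 0 \<le> j \<and> \<bar>perturbed_sine a t K s j b\<bar> < c}"
      and none: "\<forall>k N. b \<notin> Z k N"
    obtain k where k: "1 / real (Suc k) < c"
      using \<open>c > 0\<close> nat_approx_posE by metis
    obtain B where B: "\<And>j. Suc 0 \<le> j \<Longrightarrow> \<bar>perturbed_sine a t K s j b\<bar> < c \<Longrightarrow> j \<le> B"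
      using fin unfolding finite_nat_set_iff_bounded_le by blast
    have "1 / real (Suc k) \<le> \<bar>perturbed_sine a t K s j b\<bar>" if "j \<ge> Suc B" for j
      using B [of j] that k by force
    then show "b \<in> \<rat>"
      using none by (auto simp: Z_def)
  qed
  ultimately show ?thesis
    by (intro AE_I') (auto simp: negligible_iff_null_sets)
qed

theorem theorem2p5:
  fixes n :: nat and \<alpha> :: real
  assumes "n \<ge> 2"
    and "\<alpha> \<notin> {- real n / 2 - real k | k :: nat. True}"
    and "rho n \<alpha> \<noteq> 0"
    and "rho n \<alpha> \<noteq> 1"
  shows "AE \<beta> in lebesgue. \<beta> \<in> {0<..<1} \<longrightarrow>
    (\<forall>c::real. c > 0 \<longrightarrow>
      infinite {j :: nat. j \<ge> 1 \<and>
        \<bar>real j * sin (pi * (real j * \<beta> - r0 n \<alpha> \<beta>))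
          + rho n \<alpha> * (rho n \<alpha> - 1) * sin (pi * (real j * \<beta> - r1 n \<alpha> \<beta>))\<bar> < c})"
proof -
  \<comment> \<open>\<open>r0\<close> and \<open>r1\<close> are affine in \<open>\<beta>\<close>; their slopes go into the frequencies\<close>
  define a where "a = (real n - 1) / 2"
  define t where "t = (rho n \<alpha> - 1) / 2"
  define K where "K = rho n \<alpha> * (rho n \<alpha> - 1)"
  have "a \<ge> 0"
    using \<open>n \<ge> 2\<close> by (simp add: a_def)
  have expr: "real j * sin (pi * (real j * \<beta> - r0 n \<alpha> \<beta>))
      + rho n \<alpha> * (rho n \<alpha> - 1) * sin (pi * (real j * \<beta> - r1 n \<alpha> \<beta>))
      = perturbed_sine a t K (t - 1 / 2) j \<beta>" for j \<beta>
  proof -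
    have "real j * \<beta> - r0 n \<alpha> \<beta> = (real j + a) * \<beta> - t"
      by (simp add: r0_def a_def t_def field_simps)
    moreover have "real j * \<beta> - r1 n \<alpha> \<beta> = (real j + a + 1) * \<beta> - (t - 1 / 2)"
      by (simp add: r1_def r0_def a_def t_def field_simps)
    ultimately show ?thesis
      by (simp only: perturbed_sine_def K_def)
  qed
  show ?thesis
    unfolding expr using AE_infinite_small_perturbed_sine [OF \<open>a \<ge> 0\<close>, of t K "t - 1 / 2"]
    by (rule AE_mp) simp
qed

end
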